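(* Let $\mathscr C$ be an essentially small additive category and $m$ an object in $\mathscr C$. Let $\mathcal U:m\backslash\mathscr C\to\mathscr C$ be the standard forgetful functor $(a,f)\mapsto a$ and $\mathcal S:\mathscr C\to m\backslash\mathscr C$ the section $a\mapsto(a,0)$. Then the group homomorphism $$K(\mathcal U):K(m\backslash\mathscr C)\to K(\mathscr C)$$ is an isomorphism. Its inverse is $$K(\mathcal S):K(\mathscr C)\to K(m\backslash\mathscr C).$$
   Context: $m\backslash\mathscr C$ is the category whose objects are pairs $(a,f)$ with $f:m\to a$ a morphism of $\mathscr C$, whose morphisms $(a,f)\to(a',f')$ are the morphisms $\chi:a\to a'$ of $\mathscr C$ with $\chi\circ f=f'$, with composition as in $\mathscr C$. It has finite products, with $(a,f)\times(a',f')=(a\oplus a',(f,f'))$. $\mathcal U$ and $\mathcal S$ are the identity on underlying morphisms and preserve finite products. For an essentially small category $\mathscr D$ with finite products, $K(\mathscr D)$ is the Grothendieck group (group completion) of the commutative monoid of isomorphism classes of objects with $[a]+[b]=[a\times b]$; a product-preserving functor $\mathcal F$ induces the homomorphism $K(\mathcal F):[a]-[b]\mapsto[\mathcal F(a)]-[\mathcal F(b)]$. (For additive $\mathscr D$ this is the split Grothendieck group.) *)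

theory Defs
  imports "HOL-Algebra.Group"
begin

text \<open>
  Hom-sets are indexed by their source and target and need not be disjoint, so composition and
  identities carry the objects as arguments: \<open>Comp C a b c g f\<close> is \<open>g \<circ> f\<close> for
  \<open>f : a \<rightarrow> b\<close> and \<open>g : b \<rightarrow> c\<close>. Objects and morphisms are elements of HOL types, hence
  all objects, all morphisms and all isomorphism classes form sets, and (essential) smallness
  is automatic.
\<close>

record ('o, 'm) category =
  Obj :: "'o set"
  Hom :: "'o \<Rightarrow> 'o \<Rightarrow> 'm set"
  Comp :: "'o \<Rightarrow> 'o \<Rightarrow> 'o \<Rightarrow> 'm \<Rightarrow> 'm \<Rightarrow> 'm"
  Ident :: "'o \<Rightarrow> 'm"

locale category =
  fixes C :: "('o, 'm, 'e) category_scheme" (structure)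
  assumes Comp_closed:
      "\<lbrakk>a \<in> Obj C; b \<in> Obj C; c \<in> Obj C; f \<in> Hom C a b; g \<in> Hom C b c\<rbrakk>
        \<Longrightarrow> Comp C a b c g f \<in> Hom C a c"
    and Comp_assoc:
      "\<lbrakk>a \<in> Obj C; b \<in> Obj C; c \<in> Obj C; d \<in> Obj C;
        f \<in> Hom C a b; g \<in> Hom C b c; h \<in> Hom C c d\<rbrakk>
        \<Longrightarrow> Comp C a c d h (Comp C a b c g f) = Comp C a b d (Comp C b c d h g) f"
    and Ident_closed: "a \<in> Obj C \<Longrightarrow> Ident C a \<in> Hom C a a"
    and Ident_right: "\<lbrakk>a \<in> Obj C; b \<in> Obj C; f \<in> Hom C a b\<rbrakk> \<Longrightarrow> Comp C a a b f (Ident C a) = f"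
    and Ident_left: "\<lbrakk>a \<in> Obj C; b \<in> Obj C; f \<in> Hom C a b\<rbrakk> \<Longrightarrow> Comp C a b b (Ident C b) f = f"

definition isomorphic :: "('o, 'm, 'e) category_scheme \<Rightarrow> 'o \<Rightarrow> 'o \<Rightarrow> bool" where
  "isomorphic C a b \<longleftrightarrow>
    (\<exists>f\<in>Hom C a b. \<exists>g\<in>Hom C b a. Comp C a b a g f = Ident C a \<and> Comp C b a b f g = Ident C b)"

definition iso_class :: "('o, 'm, 'e) category_scheme \<Rightarrow> 'o \<Rightarrow> 'o set" where
  "iso_class C a = {b \<in> Obj C. isomorphic C a b}"

definition is_terminal :: "('o, 'm, 'e) category_scheme \<Rightarrow> 'o \<Rightarrow> bool" where
  "is_terminal C t \<longleftrightarrow> t \<in> Obj C \<and> (\<forall>a\<in>Obj C. \<exists>!f. f \<in> Hom C a t)"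

definition is_initial :: "('o, 'm, 'e) category_scheme \<Rightarrow> 'o \<Rightarrow> bool" where
  "is_initial C t \<longleftrightarrow> t \<in> Obj C \<and> (\<forall>a\<in>Obj C. \<exists>!f. f \<in> Hom C t a)"

definition is_product ::
  "('o, 'm, 'e) category_scheme \<Rightarrow> 'o \<Rightarrow> 'm \<Rightarrow> 'm \<Rightarrow> 'o \<Rightarrow> 'o \<Rightarrow> bool" where
  "is_product C p \<pi>\<^sub>1 \<pi>\<^sub>2 a b \<longleftrightarrow>
    p \<in> Obj C \<and> a \<in> Obj C \<and> b \<in> Obj C \<and> \<pi>\<^sub>1 \<in> Hom C p a \<and> \<pi>\<^sub>2 \<in> Hom C p b \<and>
    (\<forall>x\<in>Obj C. \<forall>f\<in>Hom C x a. \<forall>g\<in>Hom C x b.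
      \<exists>!h. h \<in> Hom C x p \<and> Comp C x p a \<pi>\<^sub>1 h = f \<and> Comp C x p b \<pi>\<^sub>2 h = g)"

locale fp_category = category +
  assumes ex_terminal: "\<exists>t. is_terminal C t"
    and ex_product:
      "\<lbrakk>a \<in> Obj C; b \<in> Obj C\<rbrakk> \<Longrightarrow> \<exists>p \<pi>\<^sub>1 \<pi>\<^sub>2. is_product C p \<pi>\<^sub>1 \<pi>\<^sub>2 a b"

record ('o, 'm, 'p, 'n) cat_functor =
  FObj :: "'o \<Rightarrow> 'p"
  FHom :: "'o \<Rightarrow> 'o \<Rightarrow> 'm \<Rightarrow> 'n"

locale product_functor = D: fp_category D + E: fp_category E
  for D :: "('o, 'm, 'd) category_scheme" and E :: "('p, 'n, 'e) category_scheme" +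
  fixes F :: "('o, 'm, 'p, 'n) cat_functor"
  assumes FObj_closed: "a \<in> Obj D \<Longrightarrow> FObj F a \<in> Obj E"
    and FHom_closed: "\<lbrakk>a \<in> Obj D; b \<in> Obj D; f \<in> Hom D a b\<rbrakk>
        \<Longrightarrow> FHom F a b f \<in> Hom E (FObj F a) (FObj F b)"
    and FHom_Ident: "a \<in> Obj D \<Longrightarrow> FHom F a a (Ident D a) = Ident E (FObj F a)"
    and FHom_Comp:
      "\<lbrakk>a \<in> Obj D; b \<in> Obj D; c \<in> Obj D; f \<in> Hom D a b; g \<in> Hom D b c\<rbrakk>
        \<Longrightarrow> FHom F a c (Comp D a b c g f)
            = Comp E (FObj F a) (FObj F b) (FObj F c) (FHom F b c g) (FHom F a b f)"
    and preserves_terminal: "is_terminal D t \<Longrightarrow> is_terminal E (FObj F t)"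
    and preserves_product: "is_product D p \<pi>\<^sub>1 \<pi>\<^sub>2 a b
        \<Longrightarrow> is_product E (FObj F p) (FHom F p a \<pi>\<^sub>1) (FHom F p b \<pi>\<^sub>2) (FObj F a) (FObj F b)"

record ('o, 'm) additive_category = "('o, 'm) category" +
  Add :: "'o \<Rightarrow> 'o \<Rightarrow> 'm \<Rightarrow> 'm \<Rightarrow> 'm"
  Zero :: "'o \<Rightarrow> 'o \<Rightarrow> 'm"

definition hom_group :: "('o, 'm, 'e) additive_category_scheme \<Rightarrow> 'o \<Rightarrow> 'o \<Rightarrow> 'm monoid" where
  "hom_group C a b = \<lparr>carrier = Hom C a b, mult = Add C a b, one = Zero C a b\<rparr>"

definition is_biproduct ::
  "('o, 'm, 'e) additive_category_scheme \<Rightarrow> 'o \<Rightarrow> 'm \<Rightarrow> 'm \<Rightarrow> 'm \<Rightarrow> 'm \<Rightarrow> 'o \<Rightarrow> 'o \<Rightarrow> bool" where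
  "is_biproduct C c p\<^sub>1 p\<^sub>2 i\<^sub>1 i\<^sub>2 a b \<longleftrightarrow>
    c \<in> Obj C \<and> a \<in> Obj C \<and> b \<in> Obj C \<and>
    p\<^sub>1 \<in> Hom C c a \<and> p\<^sub>2 \<in> Hom C c b \<and> i\<^sub>1 \<in> Hom C a c \<and> i\<^sub>2 \<in> Hom C b c \<and>
    Comp C a c a p\<^sub>1 i\<^sub>1 = Ident C a \<and> Comp C b c b p\<^sub>2 i\<^sub>2 = Ident C b \<and>
    Comp C b c a p\<^sub>1 i\<^sub>2 = Zero C b a \<and> Comp C a c b p\<^sub>2 i\<^sub>1 = Zero C a b \<and>
    Add C c c (Comp C c a c i\<^sub>1 p\<^sub>1) (Comp C c b c i\<^sub>2 p\<^sub>2) = Ident C c"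

locale additive_category = category C
  for C :: "('o, 'm, 'e) additive_category_scheme" (structure) +
  assumes hom_group: "\<lbrakk>a \<in> Obj C; b \<in> Obj C\<rbrakk> \<Longrightarrow> comm_group (hom_group C a b)"
    and Comp_Add_left:
      "\<lbrakk>a \<in> Obj C; b \<in> Obj C; c \<in> Obj C; f \<in> Hom C a b; g \<in> Hom C b c; g' \<in> Hom C b c\<rbrakk>
        \<Longrightarrow> Comp C a b c (Add C b c g g') f
            = Add C a c (Comp C a b c g f) (Comp C a b c g' f)"
    and Comp_Add_right:
      "\<lbrakk>a \<in> Obj C; b \<in> Obj C; c \<in> Obj C; f \<in> Hom C a b; f' \<in> Hom C a b; g \<in> Hom C b c\<rbrakk>
        \<Longrightarrow> Comp C a b c g (Add C a b f f')
            = Add C a c (Comp C a b c g f) (Comp C a b c g f')"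
    and ex_zero_object: "\<exists>z. is_initial C z \<and> is_terminal C z"
    and ex_biproduct:
      "\<lbrakk>a \<in> Obj C; b \<in> Obj C\<rbrakk> \<Longrightarrow> \<exists>c p\<^sub>1 p\<^sub>2 i\<^sub>1 i\<^sub>2. is_biproduct C c p\<^sub>1 p\<^sub>2 i\<^sub>1 i\<^sub>2 a b"

definition coslice :: "'o \<Rightarrow> ('o, 'm, 'e) category_scheme \<Rightarrow> ('o \<times> 'm, 'm) category" where
  "coslice m C =
    \<lparr>Obj = {(a, f). a \<in> Obj C \<and> f \<in> Hom C m a},
     Hom = (\<lambda>(a, f) (a', f'). {\<chi> \<in> Hom C a a'. Comp C m a a' \<chi> f = f'}),
     Comp = (\<lambda>(a, _) (b, _) (c, _). Comp C a b c),
     Ident = (\<lambda>(a, _). Ident C a)\<rparr>"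

definition forget_functor :: "('o \<times> 'm, 'm, 'o, 'm) cat_functor" where
  "forget_functor = \<lparr>FObj = (\<lambda>(a, f). a), FHom = (\<lambda>_ _ \<chi>. \<chi>)\<rparr>"

definition zero_section ::
  "'o \<Rightarrow> ('o, 'm, 'e) additive_category_scheme \<Rightarrow> ('o, 'm, 'o \<times> 'm, 'm) cat_functor" where
  "zero_section m C = \<lparr>FObj = (\<lambda>a. (a, Zero C m a)), FHom = (\<lambda>_ _ \<chi>. \<chi>)\<rparr>"

text \<open>
  The product of two isomorphism classes consists of all products of their members, which avoids
  choosing products; the empty product gives the class of terminal objects. Following
  \<^theory>\<open>HOL-Algebra.Group\<close>, the commutative monoid of isomorphism classes and its group
  completion are written multiplicatively.
\<close>

definition iso_class_monoid :: "('o, 'm, 'e) category_scheme \<Rightarrow> 'o set monoid" where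
  "iso_class_monoid D =
    \<lparr>carrier = iso_class D ` Obj D,
     mult = (\<lambda>A B. {p. \<exists>a\<in>A. \<exists>b\<in>B. \<exists>\<pi>\<^sub>1 \<pi>\<^sub>2. is_product D p \<pi>\<^sub>1 \<pi>\<^sub>2 a b}),
     one = {t. is_terminal D t}\<rparr>"

definition completion_rel :: "('a, 'b) monoid_scheme \<Rightarrow> (('a \<times> 'a) \<times> 'a \<times> 'a) set" where
  "completion_rel M =
    {((a, b), (c, d)) | a b c d. {a, b, c, d} \<subseteq> carrier M \<and>
      (\<exists>k\<in>carrier M. a \<otimes>\<^bsub>M\<^esub> d \<otimes>\<^bsub>M\<^esub> k = c \<otimes>\<^bsub>M\<^esub> b \<otimes>\<^bsub>M\<^esub> k)}"

definition group_completion :: "('a, 'b) monoid_scheme \<Rightarrow> ('a \<times> 'a) set monoid" where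
  "group_completion M =
    \<lparr>carrier = (carrier M \<times> carrier M) // completion_rel M,
     mult = (\<lambda>X Y. \<Union>(a, b)\<in>X. \<Union>(c, d)\<in>Y. completion_rel M `` {(a \<otimes>\<^bsub>M\<^esub> c, b \<otimes>\<^bsub>M\<^esub> d)}),
     one = completion_rel M `` {(\<one>\<^bsub>M\<^esub>, \<one>\<^bsub>M\<^esub>)}\<rparr>"

definition K_group :: "('o, 'm, 'e) category_scheme \<Rightarrow> ('o set \<times> 'o set) set monoid" where
  "K_group D = group_completion (iso_class_monoid D)"

text \<open>The element \<open>[a] - [b]\<close> of the Grothendieck group.\<close>

definition K_diff :: "('o, 'm, 'e) category_scheme \<Rightarrow> 'o \<Rightarrow> 'o \<Rightarrow> ('o set \<times> 'o set) set" where
  "K_diff D a b = completion_rel (iso_class_monoid D) `` {(iso_class D a, iso_class D b)}"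

definition K_map ::
  "('o, 'm, 'd) category_scheme \<Rightarrow> ('p, 'n, 'e) category_scheme \<Rightarrow> ('o, 'm, 'p, 'n) cat_functor
    \<Rightarrow> ('o set \<times> 'o set) set \<Rightarrow> ('p set \<times> 'p set) set" where
  "K_map D E F x =
    (THE y. \<exists>a\<in>Obj D. \<exists>b\<in>Obj D. x = K_diff D a b \<and> y = K_diff E (FObj F a) (FObj F b))"

context category
begin

lemma is_productD:
  assumes "is_product C p \<pi>\<^sub>1 \<pi>\<^sub>2 a b"
  shows "p \<in> Obj C" "a \<in> Obj C" "b \<in> Obj C" "\<pi>\<^sub>1 \<in> Hom C p a" "\<pi>\<^sub>2 \<in> Hom C p b"
  using assms by (auto simp: is_product_def)

lemma is_product_ex:
  assumes "is_product C p \<pi>\<^sub>1 \<pi>\<^sub>2 a b" "x \<in> Obj C" "f \<in> Hom C x a" "g \<in> Hom C x b"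
  obtains h where "h \<in> Hom C x p" "Comp C x p a \<pi>\<^sub>1 h = f" "Comp C x p b \<pi>\<^sub>2 h = g"
  using assms unfolding is_product_def by blast

lemma is_product_eqI:
  assumes "is_product C p \<pi>\<^sub>1 \<pi>\<^sub>2 a b" "x \<in> Obj C" "h \<in> Hom C x p" "k \<in> Hom C x p"
    and "Comp C x p a \<pi>\<^sub>1 h = Comp C x p a \<pi>\<^sub>1 k" "Comp C x p b \<pi>\<^sub>2 h = Comp C x p b \<pi>\<^sub>2 k"
  shows "h = k"
proof -
  have "Comp C x p a \<pi>\<^sub>1 h \<in> Hom C x a" "Comp C x p b \<pi>\<^sub>2 h \<in> Hom C x b"
    using is_productD[OF assms(1)] assms(2,3) by (auto intro: Comp_closed)
  then show ?thesis
    using assms unfolding is_product_def by metis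
qed

lemma is_productI:
  assumes "p \<in> Obj C" "a \<in> Obj C" "b \<in> Obj C" "\<pi>\<^sub>1 \<in> Hom C p a" "\<pi>\<^sub>2 \<in> Hom C p b"
    and "\<And>x f g. \<lbrakk>x \<in> Obj C; f \<in> Hom C x a; g \<in> Hom C x b\<rbrakk>
        \<Longrightarrow> \<exists>h\<in>Hom C x p. Comp C x p a \<pi>\<^sub>1 h = f \<and> Comp C x p b \<pi>\<^sub>2 h = g"
    and "\<And>x h k. \<lbrakk>x \<in> Obj C; h \<in> Hom C x p; k \<in> Hom C x p;
          Comp C x p a \<pi>\<^sub>1 h = Comp C x p a \<pi>\<^sub>1 k; Comp C x p b \<pi>\<^sub>2 h = Comp C x p b \<pi>\<^sub>2 k\<rbrakk> \<Longrightarrow> h = k"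
  shows "is_product C p \<pi>\<^sub>1 \<pi>\<^sub>2 a b"
  unfolding is_product_def using assms(1-5)
proof (intro conjI ballI)
  fix x f g assume x: "x \<in> Obj C" "f \<in> Hom C x a" "g \<in> Hom C x b"
  obtain h where "h\<in>Hom C x p" "Comp C x p a \<pi>\<^sub>1 h = f" "Comp C x p b \<pi>\<^sub>2 h = g"
    using assms(6)[OF x] by blast
  then show "\<exists>!h. h \<in> Hom C x p \<and> Comp C x p a \<pi>\<^sub>1 h = f \<and> Comp C x p b \<pi>\<^sub>2 h = g"
    by - (rule ex1I[of _ h], simp, rule assms(7)[OF x(1)], simp_all)
qed auto

lemma isomorphic_refl: "a \<in> Obj C \<Longrightarrow> isomorphic C a a"
  unfolding isomorphic_def using Ident_closed Ident_left by blast

lemma isomorphic_sym: "isomorphic C a b \<Longrightarrow> isomorphic C b a"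
  unfolding isomorphic_def by blast

lemma isomorphic_trans:
  assumes "isomorphic C a b" "isomorphic C b c" and obj: "a \<in> Obj C" "b \<in> Obj C" "c \<in> Obj C"
  shows "isomorphic C a c"
proof -
  obtain f g where f: "f \<in> Hom C a b" "g \<in> Hom C b a"
      "Comp C a b a g f = Ident C a" "Comp C b a b f g = Ident C b"
    using assms(1) unfolding isomorphic_def by blast
  obtain h k where h: "h \<in> Hom C b c" "k \<in> Hom C c b"
      "Comp C b c b k h = Ident C b" "Comp C c b c h k = Ident C c"
    using assms(2) unfolding isomorphic_def by blast
  have "Comp C a c a (Comp C c b a g k) (Comp C a b c h f)
      = Comp C a b a (Comp C b c a (Comp C c b a g k) h) f"
    using obj f h by (simp add: Comp_assoc Comp_closed)
  also have "Comp C b c a (Comp C c b a g k) h = Comp C b b a g (Comp C b c b k h)"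
    using obj f h by (subst Comp_assoc) auto
  finally have 1: "Comp C a c a (Comp C c b a g k) (Comp C a b c h f) = Ident C a"
    using obj f h by (simp add: Ident_right)
  have "Comp C c a c (Comp C a b c h f) (Comp C c b a g k)
      = Comp C c b c (Comp C b a c (Comp C a b c h f) g) k"
    using obj f h by (simp add: Comp_assoc Comp_closed)
  also have "Comp C b a c (Comp C a b c h f) g = Comp C b b c h (Comp C b a b f g)"
    using obj f h by (subst Comp_assoc) auto
  finally have 2: "Comp C c a c (Comp C a b c h f) (Comp C c b a g k) = Ident C c"
    using obj f h by (simp add: Ident_right)
  show ?thesis
    unfolding isomorphic_def using 1 2 obj f h Comp_closed by metis
qed

lemma iso_class_eq_iff:
  assumes "a \<in> Obj C" "b \<in> Obj C"
  shows "iso_class C a = iso_class C b \<longleftrightarrow> isomorphic C a b"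
  using assms isomorphic_refl isomorphic_sym isomorphic_trans unfolding iso_class_def by blast

lemma product_transport_obj:
  assumes prod: "is_product C p \<pi>\<^sub>1 \<pi>\<^sub>2 a b" and q: "q \<in> Obj C"
    and h: "h \<in> Hom C q p" "h' \<in> Hom C p q"
      "Comp C q p q h' h = Ident C q" "Comp C p q p h h' = Ident C p"
  shows "is_product C q (Comp C q p a \<pi>\<^sub>1 h) (Comp C q p b \<pi>\<^sub>2 h) a b"
proof (rule is_productI)
  note [simp] = is_productD[OF prod] q h
  show "Comp C q p a \<pi>\<^sub>1 h \<in> Hom C q a" "Comp C q p b \<pi>\<^sub>2 h \<in> Hom C q b"
    by (auto intro: Comp_closed)
  fix x assume x[simp]: "x \<in> Obj C"
  {
    fix f g assume f: "f \<in> Hom C x a" "g \<in> Hom C x b"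
    obtain k where k: "k \<in> Hom C x p" "Comp C x p a \<pi>\<^sub>1 k = f" "Comp C x p b \<pi>\<^sub>2 k = g"
      using is_product_ex[OF prod x f] .
    have "Comp C x q p h (Comp C x p q h' k) = k"
      using k by (subst Comp_assoc) (auto simp: Ident_left)
    then show "\<exists>l\<in>Hom C x q. Comp C x q a (Comp C q p a \<pi>\<^sub>1 h) l = f
        \<and> Comp C x q b (Comp C q p b \<pi>\<^sub>2 h) l = g"
      using k by (intro bexI[of _ "Comp C x p q h' k"])
        (auto intro: Comp_closed simp: Comp_assoc[symmetric] Comp_closed)
  next
    fix k l assume k: "k \<in> Hom C x q" "l \<in> Hom C x q"
      and eq: "Comp C x q a (Comp C q p a \<pi>\<^sub>1 h) k = Comp C x q a (Comp C q p a \<pi>\<^sub>1 h) l"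
        "Comp C x q b (Comp C q p b \<pi>\<^sub>2 h) k = Comp C x q b (Comp C q p b \<pi>\<^sub>2 h) l"
    have "Comp C x q p h k = Comp C x q p h l"
      using k eq by - (rule is_product_eqI[OF prod x], auto intro: Comp_closed simp: Comp_assoc)
    then have "Comp C x p q h' (Comp C x q p h k) = Comp C x p q h' (Comp C x q p h l)"
      by simp
    then show "k = l" using k by (simp add: Comp_assoc Ident_left)
  }
qed (use is_productD[OF prod] q in auto)

lemma product_transport_factor:
  assumes prod: "is_product C p \<pi>\<^sub>1 \<pi>\<^sub>2 a b" and a': "a' \<in> Obj C"
    and u: "u \<in> Hom C a a'" "u' \<in> Hom C a' a"
      "Comp C a a' a u' u = Ident C a" "Comp C a' a a' u u' = Ident C a'"
  shows "is_product C p (Comp C p a a' u \<pi>\<^sub>1) \<pi>\<^sub>2 a' b"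
proof (rule is_productI)
  note [simp] = is_productD[OF prod] a' u
  show "Comp C p a a' u \<pi>\<^sub>1 \<in> Hom C p a'"
    by (auto intro: Comp_closed)
  fix x assume x[simp]: "x \<in> Obj C"
  {
    fix f g assume f: "f \<in> Hom C x a'" "g \<in> Hom C x b"
    obtain k where k: "k \<in> Hom C x p" "Comp C x p a \<pi>\<^sub>1 k = Comp C x a' a u' f"
        "Comp C x p b \<pi>\<^sub>2 k = g"
      by (rule is_product_ex[OF prod x _ f(2), of "Comp C x a' a u' f"])
         (use f in \<open>auto intro: Comp_closed\<close>)
    have "Comp C x a a' u (Comp C x a' a u' f) = f"
      using f by (subst Comp_assoc) (auto simp: Ident_left)
    then show "\<exists>l\<in>Hom C x p. Comp C x p a' (Comp C p a a' u \<pi>\<^sub>1) l = f \<and> Comp C x p b \<pi>\<^sub>2 l = g"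
      using k by (intro bexI[of _ k]) (auto simp: Comp_assoc[symmetric])
  next
    fix k l assume k: "k \<in> Hom C x p" "l \<in> Hom C x p"
      and eq: "Comp C x p a' (Comp C p a a' u \<pi>\<^sub>1) k = Comp C x p a' (Comp C p a a' u \<pi>\<^sub>1) l"
        "Comp C x p b \<pi>\<^sub>2 k = Comp C x p b \<pi>\<^sub>2 l"
    have "Comp C x a a' u (Comp C x p a \<pi>\<^sub>1 k) = Comp C x a a' u (Comp C x p a \<pi>\<^sub>1 l)"
      using k eq by (simp add: Comp_assoc)
    then have "Comp C x a' a u' (Comp C x a a' u (Comp C x p a \<pi>\<^sub>1 k))
        = Comp C x a' a u' (Comp C x a a' u (Comp C x p a \<pi>\<^sub>1 l))" by simp
    then have "Comp C x a a (Comp C a a' a u' u) (Comp C x p a \<pi>\<^sub>1 k)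
        = Comp C x a a (Comp C a a' a u' u) (Comp C x p a \<pi>\<^sub>1 l)"
      using k by (subst (asm) (1 2) Comp_assoc) (auto intro: Comp_closed)
    then have "Comp C x p a \<pi>\<^sub>1 k = Comp C x p a \<pi>\<^sub>1 l"
      using k by (simp add: Ident_left Comp_closed)
    then show "k = l" using k eq by - (rule is_product_eqI[OF prod x], auto)
  }
qed (use is_productD[OF prod] a' in auto)

lemma is_product_swap: "is_product C p \<pi>\<^sub>1 \<pi>\<^sub>2 a b \<Longrightarrow> is_product C p \<pi>\<^sub>2 \<pi>\<^sub>1 b a"
  unfolding is_product_def by metis

lemma product_comparison:
  assumes p: "is_product C p \<pi>\<^sub>1 \<pi>\<^sub>2 a b" and q: "is_product C q \<rho>\<^sub>1 \<rho>\<^sub>2 a b"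
  obtains h h' where "h \<in> Hom C q p" "h' \<in> Hom C p q"
    "Comp C q p q h' h = Ident C q" "Comp C p q p h h' = Ident C p"
    "Comp C q p a \<pi>\<^sub>1 h = \<rho>\<^sub>1" "Comp C q p b \<pi>\<^sub>2 h = \<rho>\<^sub>2"
proof -
  note [simp] = is_productD[OF p] is_productD[OF q]
  obtain h where h: "h \<in> Hom C q p" "Comp C q p a \<pi>\<^sub>1 h = \<rho>\<^sub>1" "Comp C q p b \<pi>\<^sub>2 h = \<rho>\<^sub>2"
    by (rule is_product_ex[OF p, of q \<rho>\<^sub>1 \<rho>\<^sub>2]) auto
  obtain h' where h': "h' \<in> Hom C p q" "Comp C p q a \<rho>\<^sub>1 h' = \<pi>\<^sub>1" "Comp C p q b \<rho>\<^sub>2 h' = \<pi>\<^sub>2"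
    by (rule is_product_ex[OF q, of p \<pi>\<^sub>1 \<pi>\<^sub>2]) auto
  have "Comp C q p q h' h = Ident C q"
    using h h' by - (rule is_product_eqI[OF q, of q], auto intro: Comp_closed Ident_closed simp: Comp_assoc Ident_right)
  moreover have "Comp C p q p h h' = Ident C p"
    using h h' by - (rule is_product_eqI[OF p, of p], auto intro: Comp_closed Ident_closed simp: Comp_assoc Ident_right)
  ultimately show thesis using that h h' by blast
qed

lemma product_unique_iso:
  assumes "is_product C p \<pi>\<^sub>1 \<pi>\<^sub>2 a b" "is_product C q \<rho>\<^sub>1 \<rho>\<^sub>2 a b"
  shows "isomorphic C p q"
  by (rule product_comparison[OF assms]) (auto simp: isomorphic_def)

lemma product_iso_factor:
  assumes "is_product C p \<pi>\<^sub>1 \<pi>\<^sub>2 a b" "isomorphic C a a'" "a' \<in> Obj C"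
  shows "\<exists>\<rho>\<^sub>1 \<rho>\<^sub>2. is_product C p \<rho>\<^sub>1 \<rho>\<^sub>2 a' b"
  using assms product_transport_factor unfolding isomorphic_def by blast

lemma product_iso_factors:
  assumes "is_product C p \<pi>\<^sub>1 \<pi>\<^sub>2 a b" "isomorphic C a a'" "a' \<in> Obj C"
    "isomorphic C b b'" "b' \<in> Obj C"
  shows "\<exists>\<rho>\<^sub>1 \<rho>\<^sub>2. is_product C p \<rho>\<^sub>1 \<rho>\<^sub>2 a' b'"
  using product_iso_factor[OF assms(1-3)] product_iso_factor is_product_swap assms(4,5) by meson

lemma product_iso_obj:
  assumes "is_product C p \<pi>\<^sub>1 \<pi>\<^sub>2 a b" "isomorphic C p q" "q \<in> Obj C"
  shows "\<exists>\<rho>\<^sub>1 \<rho>\<^sub>2. is_product C q \<rho>\<^sub>1 \<rho>\<^sub>2 a b"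
  using assms product_transport_obj unfolding isomorphic_def by blast

lemma product_assoc:
  assumes q: "is_product C q \<alpha>\<^sub>1 \<alpha>\<^sub>2 a b" and p: "is_product C p \<beta>\<^sub>1 \<beta>\<^sub>2 q c"
    and r: "is_product C r \<gamma>\<^sub>1 \<gamma>\<^sub>2 b c"
  shows "\<exists>\<delta>\<^sub>1 \<delta>\<^sub>2. is_product C p \<delta>\<^sub>1 \<delta>\<^sub>2 a r"
proof -
  note [simp] = is_productD[OF q] is_productD[OF p] is_productD[OF r]
  obtain d where d: "d \<in> Hom C p r" "Comp C p r b \<gamma>\<^sub>1 d = Comp C p q b \<alpha>\<^sub>2 \<beta>\<^sub>1"
      "Comp C p r c \<gamma>\<^sub>2 d = \<beta>\<^sub>2"
    by (rule is_product_ex[OF r, of p "Comp C p q b \<alpha>\<^sub>2 \<beta>\<^sub>1" \<beta>\<^sub>2]) (auto intro: Comp_closed)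
  have "is_product C p (Comp C p q a \<alpha>\<^sub>1 \<beta>\<^sub>1) d a r"
  proof (rule is_productI)
    show "Comp C p q a \<alpha>\<^sub>1 \<beta>\<^sub>1 \<in> Hom C p a" by (auto intro: Comp_closed)
    fix x assume x[simp]: "x \<in> Obj C"
    {
      fix f g assume f[simp]: "f \<in> Hom C x a" "g \<in> Hom C x r"
      obtain k where k: "k \<in> Hom C x q" "Comp C x q a \<alpha>\<^sub>1 k = f"
          "Comp C x q b \<alpha>\<^sub>2 k = Comp C x r b \<gamma>\<^sub>1 g"
        by (rule is_product_ex[OF q, of x f "Comp C x r b \<gamma>\<^sub>1 g"]) (auto intro: Comp_closed)
      obtain l where l: "l \<in> Hom C x p" "Comp C x p q \<beta>\<^sub>1 l = k"
          "Comp C x p c \<beta>\<^sub>2 l = Comp C x r c \<gamma>\<^sub>2 g"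
        by (rule is_product_ex[OF p, of x k "Comp C x r c \<gamma>\<^sub>2 g"]) (use k in \<open>auto intro: Comp_closed\<close>)
      have 1: "Comp C x p a (Comp C p q a \<alpha>\<^sub>1 \<beta>\<^sub>1) l = f"
        using k l by (simp add: Comp_assoc[symmetric])
      have "Comp C x r b \<gamma>\<^sub>1 (Comp C x p r d l) = Comp C x p b (Comp C p q b \<alpha>\<^sub>2 \<beta>\<^sub>1) l"
        using d l by (simp add: Comp_assoc)
      also have "\<dots> = Comp C x r b \<gamma>\<^sub>1 g"
        using k l by (simp add: Comp_assoc[symmetric])
      finally have "Comp C x p r d l = g"
        using d l by - (rule is_product_eqI[OF r x], auto intro: Comp_closed simp: Comp_assoc)
      then show "\<exists>l\<in>Hom C x p. Comp C x p a (Comp C p q a \<alpha>\<^sub>1 \<beta>\<^sub>1) l = f \<and> Comp C x p r d l = g"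
        using l 1 by blast
    next
      fix k l assume k: "k \<in> Hom C x p" "l \<in> Hom C x p"
        and eq: "Comp C x p a (Comp C p q a \<alpha>\<^sub>1 \<beta>\<^sub>1) k = Comp C x p a (Comp C p q a \<alpha>\<^sub>1 \<beta>\<^sub>1) l"
          "Comp C x p r d k = Comp C x p r d l"
      have eqb: "Comp C x p b (Comp C p q b \<alpha>\<^sub>2 \<beta>\<^sub>1) k = Comp C x p b (Comp C p q b \<alpha>\<^sub>2 \<beta>\<^sub>1) l"
        unfolding d(2)[symmetric] using k d(1) eq by (simp add: Comp_assoc[symmetric])
      have eqc: "Comp C x p c \<beta>\<^sub>2 k = Comp C x p c \<beta>\<^sub>2 l"
        unfolding d(3)[symmetric] using k d(1) eq by (simp add: Comp_assoc[symmetric])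
      have "Comp C x p q \<beta>\<^sub>1 k = Comp C x p q \<beta>\<^sub>1 l"
        using k eq eqb by - (rule is_product_eqI[OF q x], auto intro: Comp_closed simp: Comp_assoc)
      then show "k = l" using k eqc by - (rule is_product_eqI[OF p x], auto)
    }
  qed (use d in auto)
  then show ?thesis by blast
qed

lemma is_terminal_ex:
  assumes "is_terminal C t" "a \<in> Obj C"
  obtains f where "f \<in> Hom C a t"
  using assms unfolding is_terminal_def by blast

lemma is_terminal_eqI:
  assumes "is_terminal C t" "a \<in> Obj C" "f \<in> Hom C a t" "g \<in> Hom C a t"
  shows "f = g"
  using assms unfolding is_terminal_def by blast

lemma terminal_iso:
  assumes t: "is_terminal C t" and s: "is_terminal C s"
  shows "isomorphic C t s"
proof -
  have o: "t \<in> Obj C" "s \<in> Obj C" using t s by (auto simp: is_terminal_def)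
  obtain f g where f: "f \<in> Hom C t s" "g \<in> Hom C s t"
    using is_terminal_ex[OF s o(1)] is_terminal_ex[OF t o(2)] by metis
  have "Comp C t s t g f = Ident C t" "Comp C s t s f g = Ident C s"
    using is_terminal_eqI[OF t o(1)] is_terminal_eqI[OF s o(2)] f o Comp_closed Ident_closed
    by metis+
  then show ?thesis using f unfolding isomorphic_def by blast
qed

lemma iso_terminal:
  assumes t: "is_terminal C t" and "isomorphic C t s" and s: "s \<in> Obj C"
  shows "is_terminal C s"
proof -
  have o: "t \<in> Obj C" using t by (auto simp: is_terminal_def)
  obtain f g where f: "f \<in> Hom C t s" "g \<in> Hom C s t" "Comp C s t s f g = Ident C s"
    using assms(2) unfolding isomorphic_def by blast
  show ?thesis unfolding is_terminal_def
  proof (intro conjI ballI s)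
    fix a assume a: "a \<in> Obj C"
    obtain k where k: "k \<in> Hom C a t" using is_terminal_ex[OF t a] .
    show "\<exists>!h. h \<in> Hom C a s"
    proof (rule ex1I)
      show "Comp C a t s f k \<in> Hom C a s" using k f a s o Comp_closed by blast
      fix h assume h: "h \<in> Hom C a s"
      have "h = Comp C a s s (Comp C s t s f g) h" using f h a s by (simp add: Ident_left)
      also have "\<dots> = Comp C a t s f (Comp C a s t g h)"
        using f h a s o by (simp add: Comp_assoc)
      also have "Comp C a s t g h = k"
        using is_terminal_eqI[OF t a] k f h a s o Comp_closed by blast
      finally show "h = Comp C a t s f k" .
    qed
  qed
qed

lemma product_terminal:
  assumes t: "is_terminal C t" and a: "a \<in> Obj C"
  shows "\<exists>\<pi>\<^sub>1 \<pi>\<^sub>2. is_product C a \<pi>\<^sub>1 \<pi>\<^sub>2 t a"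
proof -
  have o: "t \<in> Obj C" using t by (auto simp: is_terminal_def)
  obtain k where k: "k \<in> Hom C a t" using is_terminal_ex[OF t a] .
  have "is_product C a k (Ident C a) t a"
  proof (rule is_productI)
    fix x f g assume x: "x \<in> Obj C" "f \<in> Hom C x t" "g \<in> Hom C x a"
    have "Comp C x a t k g \<in> Hom C x t" using x a k o by (auto intro: Comp_closed)
    then have "Comp C x a t k g = f" using is_terminal_eqI[OF t x(1)] x(2) by blast
    then show "\<exists>h\<in>Hom C x a. Comp C x a t k h = f \<and> Comp C x a a (Ident C a) h = g"
      using x a by (auto simp: Ident_left)
  next
    fix x h h' assume "x \<in> Obj C" "h \<in> Hom C x a" "h' \<in> Hom C x a"
      "Comp C x a a (Ident C a) h = Comp C x a a (Ident C a) h'"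
    then show "h = h'" using a by (simp add: Ident_left)
  qed (use a k o Ident_closed in auto)
  then show ?thesis by blast
qed

lemma iso_class_mult:
  assumes p: "is_product C p \<pi>\<^sub>1 \<pi>\<^sub>2 a b"
  shows "iso_class C a \<otimes>\<^bsub>iso_class_monoid C\<^esub> iso_class C b = iso_class C p"
proof (intro Set.set_eqI iffI)
  note o = is_productD[OF p]
  fix q assume "q \<in> iso_class C a \<otimes>\<^bsub>iso_class_monoid C\<^esub> iso_class C b"
  then obtain a' b' \<rho>\<^sub>1 \<rho>\<^sub>2 where q: "is_product C q \<rho>\<^sub>1 \<rho>\<^sub>2 a' b'" "isomorphic C a a'" "isomorphic C b b'"
    by (auto simp: iso_class_monoid_def iso_class_def)
  then obtain \<sigma>\<^sub>1 \<sigma>\<^sub>2 where "is_product C q \<sigma>\<^sub>1 \<sigma>\<^sub>2 a b"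
    using product_iso_factors[OF q(1)] o isomorphic_sym by meson
  then show "q \<in> iso_class C p"
    using p product_unique_iso is_productD unfolding iso_class_def by blast
next
  note o = is_productD[OF p]
  fix q assume "q \<in> iso_class C p"
  then obtain \<sigma>\<^sub>1 \<sigma>\<^sub>2 where "is_product C q \<sigma>\<^sub>1 \<sigma>\<^sub>2 a b"
    using product_iso_obj[OF p] unfolding iso_class_def by blast
  then show "q \<in> iso_class C a \<otimes>\<^bsub>iso_class_monoid C\<^esub> iso_class C b"
    using o isomorphic_refl by (auto simp: iso_class_monoid_def iso_class_def)
qed

lemma iso_class_one:
  assumes t: "is_terminal C t"
  shows "\<one>\<^bsub>iso_class_monoid C\<^esub> = iso_class C t"
proof (intro Set.set_eqI iffI)
  fix s
  show "s \<in> iso_class C t" if "s \<in> \<one>\<^bsub>iso_class_monoid C\<^esub>"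
    using that terminal_iso[OF t, of s]
    by (simp add: iso_class_monoid_def iso_class_def is_terminal_def)
  show "s \<in> \<one>\<^bsub>iso_class_monoid C\<^esub>" if "s \<in> iso_class C t"
    using that iso_terminal[OF t, of s] by (simp add: iso_class_monoid_def iso_class_def)
qed

end

lemma (in fp_category) comm_monoid_iso_class_monoid: "comm_monoid (iso_class_monoid C)"
proof -
  obtain t where t: "is_terminal C t" using ex_terminal by blast
  then have t_obj: "t \<in> Obj C" by (auto simp: is_terminal_def)
  note one = iso_class_one[OF t]
  have carr: "carrier (iso_class_monoid C) = iso_class C ` Obj C"
    by (simp add: iso_class_monoid_def)
  show ?thesis
  proof (rule comm_monoidI)
    fix X Y assume "X \<in> carrier (iso_class_monoid C)" "Y \<in> carrier (iso_class_monoid C)"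
    then obtain a b where ab: "X = iso_class C a" "Y = iso_class C b" "a \<in> Obj C" "b \<in> Obj C"
      by (auto simp: carr)
    obtain p \<pi>\<^sub>1 \<pi>\<^sub>2 where p: "is_product C p \<pi>\<^sub>1 \<pi>\<^sub>2 a b" using ex_product[OF ab(3,4)] by blast
    show "X \<otimes>\<^bsub>iso_class_monoid C\<^esub> Y \<in> carrier (iso_class_monoid C)"
      using is_productD(1)[OF p] by (simp add: ab iso_class_mult[OF p] carr)
    show "X \<otimes>\<^bsub>iso_class_monoid C\<^esub> Y = Y \<otimes>\<^bsub>iso_class_monoid C\<^esub> X"
      by (simp add: ab iso_class_mult[OF p] iso_class_mult[OF is_product_swap[OF p]])
  next
    fix X Y Z assume "X \<in> carrier (iso_class_monoid C)" "Y \<in> carrier (iso_class_monoid C)"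
      "Z \<in> carrier (iso_class_monoid C)"
    then obtain a b c where abc: "X = iso_class C a" "Y = iso_class C b" "Z = iso_class C c"
      and o: "a \<in> Obj C" "b \<in> Obj C" "c \<in> Obj C"
      by (auto simp: carr)
    obtain q \<alpha>\<^sub>1 \<alpha>\<^sub>2 where q: "is_product C q \<alpha>\<^sub>1 \<alpha>\<^sub>2 a b" using ex_product o by blast
    obtain p \<beta>\<^sub>1 \<beta>\<^sub>2 where p: "is_product C p \<beta>\<^sub>1 \<beta>\<^sub>2 q c"
      using ex_product o is_productD(1)[OF q] by blast
    obtain r \<gamma>\<^sub>1 \<gamma>\<^sub>2 where r: "is_product C r \<gamma>\<^sub>1 \<gamma>\<^sub>2 b c" using ex_product o by blast
    obtain \<delta>\<^sub>1 \<delta>\<^sub>2 where s: "is_product C p \<delta>\<^sub>1 \<delta>\<^sub>2 a r" using product_assoc[OF q p r] by blast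
    show "X \<otimes>\<^bsub>iso_class_monoid C\<^esub> Y \<otimes>\<^bsub>iso_class_monoid C\<^esub> Z
        = X \<otimes>\<^bsub>iso_class_monoid C\<^esub> (Y \<otimes>\<^bsub>iso_class_monoid C\<^esub> Z)"
      by (simp add: abc iso_class_mult[OF q] iso_class_mult[OF p] iso_class_mult[OF r]
          iso_class_mult[OF s])
  next
    show "\<one>\<^bsub>iso_class_monoid C\<^esub> \<in> carrier (iso_class_monoid C)"
      using t_obj by (simp add: one carr)
    fix X assume "X \<in> carrier (iso_class_monoid C)"
    then obtain a where a: "X = iso_class C a" "a \<in> Obj C" by (auto simp: carr)
    obtain \<pi>\<^sub>1 \<pi>\<^sub>2 where p: "is_product C a \<pi>\<^sub>1 \<pi>\<^sub>2 t a" using product_terminal[OF t a(2)] by blast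
    show "\<one>\<^bsub>iso_class_monoid C\<^esub> \<otimes>\<^bsub>iso_class_monoid C\<^esub> X = X"
      by (simp add: one a iso_class_mult[OF p])
  qed
qed

context comm_monoid
begin

lemma completion_rel_iff:
  "((a, b), (c, d)) \<in> completion_rel G \<longleftrightarrow>
    a \<in> carrier G \<and> b \<in> carrier G \<and> c \<in> carrier G \<and> d \<in> carrier G \<and>
    (\<exists>k\<in>carrier G. a \<otimes> d \<otimes> k = c \<otimes> b \<otimes> k)"
  by (auto simp: completion_rel_def)

lemma equiv_completion_rel: "equiv (carrier G \<times> carrier G) (completion_rel G)"
proof (rule equivI)
  show "completion_rel G \<subseteq> (carrier G \<times> carrier G) \<times> (carrier G \<times> carrier G)"
    by (auto simp: completion_rel_def)
  show "refl_on (carrier G \<times> carrier G) (completion_rel G)"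
    by (rule refl_onI) (auto simp: completion_rel_iff)
  show "sym (completion_rel G)"
    by (rule symI) (auto simp: completion_rel_iff, metis)
  show "trans (completion_rel G)"
  proof (rule transI, clarify)
    fix a b c d e f
    assume "((a, b), (c, d)) \<in> completion_rel G" "((c, d), (e, f)) \<in> completion_rel G"
    then obtain k l where c: "a \<in> carrier G" "b \<in> carrier G" "c \<in> carrier G" "d \<in> carrier G"
        "e \<in> carrier G" "f \<in> carrier G" "k \<in> carrier G" "l \<in> carrier G"
      and k: "a \<otimes> d \<otimes> k = c \<otimes> b \<otimes> k" and l: "c \<otimes> f \<otimes> l = e \<otimes> d \<otimes> l"
      by (auto simp: completion_rel_iff)
    have "a \<otimes> f \<otimes> (d \<otimes> k \<otimes> l) = (a \<otimes> d \<otimes> k) \<otimes> (f \<otimes> l)"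
      using c by (simp add: m_ac)
    also have "\<dots> = (c \<otimes> f \<otimes> l) \<otimes> (b \<otimes> k)"
      unfolding k using c by (simp add: m_ac)
    also have "\<dots> = e \<otimes> b \<otimes> (d \<otimes> k \<otimes> l)"
      unfolding l using c by (simp add: m_ac)
    finally show "((a, b), (e, f)) \<in> completion_rel G"
      unfolding completion_rel_iff using c by blast
  qed
qed

lemma completion_rel_mult:
  assumes "((a, b), (a', b')) \<in> completion_rel G" "((c, d), (c', d')) \<in> completion_rel G"
  shows "((a \<otimes> c, b \<otimes> d), (a' \<otimes> c', b' \<otimes> d')) \<in> completion_rel G"
proof -
  obtain k l where c: "a \<in> carrier G" "b \<in> carrier G" "c \<in> carrier G" "d \<in> carrier G"
      "a' \<in> carrier G" "b' \<in> carrier G" "c' \<in> carrier G" "d' \<in> carrier G"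
      "k \<in> carrier G" "l \<in> carrier G"
    and k: "a \<otimes> b' \<otimes> k = a' \<otimes> b \<otimes> k" and l: "c \<otimes> d' \<otimes> l = c' \<otimes> d \<otimes> l"
    using assms by (auto simp: completion_rel_iff)
  have "(a \<otimes> c) \<otimes> (b' \<otimes> d') \<otimes> (k \<otimes> l) = (a \<otimes> b' \<otimes> k) \<otimes> (c \<otimes> d' \<otimes> l)"
    using c by (simp add: m_ac)
  also have "\<dots> = (a' \<otimes> c') \<otimes> (b \<otimes> d) \<otimes> (k \<otimes> l)"
    unfolding k l using c by (simp add: m_ac)
  finally show ?thesis unfolding completion_rel_iff using c by blast
qed

lemma completion_mult:
  assumes "a \<in> carrier G" "b \<in> carrier G" "c \<in> carrier G" "d \<in> carrier G"
  shows "completion_rel G `` {(a, b)} \<otimes>\<^bsub>group_completion G\<^esub> completion_rel G `` {(c, d)}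
    = completion_rel G `` {(a \<otimes> c, b \<otimes> d)}"
proof -
  have eq: "completion_rel G `` {(x \<otimes> z, y \<otimes> w)} = completion_rel G `` {(a \<otimes> c, b \<otimes> d)}"
    if "((a, b), (x, y)) \<in> completion_rel G" "((c, d), (z, w)) \<in> completion_rel G" for x y z w
    using equiv_class_eq[OF equiv_completion_rel completion_rel_mult[OF that]] by simp
  have refl: "((a, b), (a, b)) \<in> completion_rel G" "((c, d), (c, d)) \<in> completion_rel G"
    using assms by (auto simp: completion_rel_iff)
  show ?thesis
    unfolding group_completion_def by (auto simp: eq intro: refl) (use eq refl in blast)+
qed

lemma carrier_completion:
  "carrier (group_completion G)
    = {completion_rel G `` {(a, b)} | a b. a \<in> carrier G \<and> b \<in> carrier G}"
  by (auto simp: group_completion_def quotient_def)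

lemma comm_group_completion: "comm_group (group_completion G)"
proof (rule comm_groupI)
  have one: "\<one>\<^bsub>group_completion G\<^esub> = completion_rel G `` {(\<one>, \<one>)}"
    by (simp add: group_completion_def)
  show "\<one>\<^bsub>group_completion G\<^esub> \<in> carrier (group_completion G)"
    unfolding one carrier_completion by blast
  fix X assume "X \<in> carrier (group_completion G)"
  then obtain a b where X: "X = completion_rel G `` {(a, b)}" "a \<in> carrier G" "b \<in> carrier G"
    by (auto simp: carrier_completion)
  show "\<one>\<^bsub>group_completion G\<^esub> \<otimes>\<^bsub>group_completion G\<^esub> X = X"
    using X by (simp add: one completion_mult)
  have "((b \<otimes> a, a \<otimes> b), (\<one>, \<one>)) \<in> completion_rel G"
    using X by (auto simp: completion_rel_iff m_comm)
  then have "completion_rel G `` {(b, a)} \<otimes>\<^bsub>group_completion G\<^esub> X = \<one>\<^bsub>group_completion G\<^esub>"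
    using X equiv_class_eq[OF equiv_completion_rel] by (simp add: one completion_mult)
  then show "\<exists>Y\<in>carrier (group_completion G).
      Y \<otimes>\<^bsub>group_completion G\<^esub> X = \<one>\<^bsub>group_completion G\<^esub>"
    using X unfolding carrier_completion by blast
  fix Y assume "Y \<in> carrier (group_completion G)"
  then obtain c d where Y: "Y = completion_rel G `` {(c, d)}" "c \<in> carrier G" "d \<in> carrier G"
    by (auto simp: carrier_completion)
  show "X \<otimes>\<^bsub>group_completion G\<^esub> Y \<in> carrier (group_completion G)"
    using X Y by (auto simp: completion_mult carrier_completion)
  show "X \<otimes>\<^bsub>group_completion G\<^esub> Y = Y \<otimes>\<^bsub>group_completion G\<^esub> X"
    using X Y by (simp add: completion_mult m_comm)
  fix Z assume "Z \<in> carrier (group_completion G)"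
  then obtain e f where Z: "Z = completion_rel G `` {(e, f)}" "e \<in> carrier G" "f \<in> carrier G"
    by (auto simp: carrier_completion)
  show "X \<otimes>\<^bsub>group_completion G\<^esub> Y \<otimes>\<^bsub>group_completion G\<^esub> Z
      = X \<otimes>\<^bsub>group_completion G\<^esub> (Y \<otimes>\<^bsub>group_completion G\<^esub> Z)"
    using X Y Z by (simp add: completion_mult m_assoc)
qed

end

context fp_category
begin

lemma comm_group_K: "comm_group (K_group C)"
  unfolding K_group_def
  by (rule comm_monoid.comm_group_completion[OF comm_monoid_iso_class_monoid])

lemma carrier_K: "carrier (K_group C) = {K_diff C a b | a b. a \<in> Obj C \<and> b \<in> Obj C}"
  unfolding K_group_def K_diff_def
    comm_monoid.carrier_completion[OF comm_monoid_iso_class_monoid]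
  by (auto simp: iso_class_monoid_def)

lemma iso_class_carrier: "a \<in> Obj C \<Longrightarrow> iso_class C a \<in> carrier (iso_class_monoid C)"
  by (simp add: iso_class_monoid_def)

lemma K_diff_mult:
  assumes "is_product C p \<pi>\<^sub>1 \<pi>\<^sub>2 a c" "is_product C q \<rho>\<^sub>1 \<rho>\<^sub>2 b d"
  shows "K_diff C a b \<otimes>\<^bsub>K_group C\<^esub> K_diff C c d = K_diff C p q"
  unfolding K_group_def K_diff_def
  using is_productD[OF assms(1)] is_productD[OF assms(2)]
  by (simp add: comm_monoid.completion_mult[OF comm_monoid_iso_class_monoid] iso_class_carrier
      iso_class_mult[OF assms(1)] iso_class_mult[OF assms(2)])

lemma K_diff_eq_iff:
  assumes "a \<in> Obj C" "b \<in> Obj C" "c \<in> Obj C" "d \<in> Obj C"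
  shows "K_diff C a b = K_diff C c d \<longleftrightarrow>
    (\<exists>k\<in>Obj C. iso_class C a \<otimes>\<^bsub>iso_class_monoid C\<^esub> iso_class C d \<otimes>\<^bsub>iso_class_monoid C\<^esub> iso_class C k
      = iso_class C c \<otimes>\<^bsub>iso_class_monoid C\<^esub> iso_class C b \<otimes>\<^bsub>iso_class_monoid C\<^esub> iso_class C k)"
proof -
  interpret M: comm_monoid "iso_class_monoid C" by (rule comm_monoid_iso_class_monoid)
  have "K_diff C a b = K_diff C c d \<longleftrightarrow>
      ((iso_class C a, iso_class C b), (iso_class C c, iso_class C d)) \<in> completion_rel (iso_class_monoid C)"
    unfolding K_diff_def using assms
    by (intro eq_equiv_class_iff[OF M.equiv_completion_rel]) (auto simp: iso_class_carrier)
  then show ?thesis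
    using assms by (auto simp: M.completion_rel_iff iso_class_carrier) (auto simp: iso_class_monoid_def)
qed

end

context product_functor
begin

lemma FObj_isomorphic:
  assumes "isomorphic D a b" "a \<in> Obj D" "b \<in> Obj D"
  shows "isomorphic E (FObj F a) (FObj F b)"
  using assms FHom_closed FHom_Comp FHom_Ident unfolding isomorphic_def by metis

lemma K_diff_FObj_cong:
  assumes o: "a \<in> Obj D" "b \<in> Obj D" "c \<in> Obj D" "d \<in> Obj D"
    and eq: "K_diff D a b = K_diff D c d"
  shows "K_diff E (FObj F a) (FObj F b) = K_diff E (FObj F c) (FObj F d)"
proof -
  obtain k where k: "k \<in> Obj D"
    and eq: "iso_class D a \<otimes>\<^bsub>iso_class_monoid D\<^esub> iso_class D d \<otimes>\<^bsub>iso_class_monoid D\<^esub> iso_class D k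
      = iso_class D c \<otimes>\<^bsub>iso_class_monoid D\<^esub> iso_class D b \<otimes>\<^bsub>iso_class_monoid D\<^esub> iso_class D k"
    using eq D.K_diff_eq_iff o by auto
  obtain p \<alpha>\<^sub>1 \<alpha>\<^sub>2 where p: "is_product D p \<alpha>\<^sub>1 \<alpha>\<^sub>2 a d" using D.ex_product o by blast
  obtain q \<beta>\<^sub>1 \<beta>\<^sub>2 where q: "is_product D q \<beta>\<^sub>1 \<beta>\<^sub>2 c b" using D.ex_product o by blast
  obtain p' \<gamma>\<^sub>1 \<gamma>\<^sub>2 where p': "is_product D p' \<gamma>\<^sub>1 \<gamma>\<^sub>2 p k"
    using D.ex_product D.is_productD(1)[OF p] k by blast
  obtain q' \<delta>\<^sub>1 \<delta>\<^sub>2 where q': "is_product D q' \<delta>\<^sub>1 \<delta>\<^sub>2 q k"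
    using D.ex_product D.is_productD(1)[OF q] k by blast
  note po = D.is_productD(1)[OF p'] D.is_productD(1)[OF q']
  have "iso_class D p' = iso_class D q'"
    using eq by (simp add: D.iso_class_mult[OF p] D.iso_class_mult[OF q]
        D.iso_class_mult[OF p'] D.iso_class_mult[OF q'])
  then have "isomorphic E (FObj F p') (FObj F q')"
    using FObj_isomorphic po by (simp add: D.iso_class_eq_iff)
  then have "iso_class E (FObj F p') = iso_class E (FObj F q')"
    using po by (simp add: E.iso_class_eq_iff FObj_closed)
  then show ?thesis
    using o k FObj_closed
    by (auto simp: E.K_diff_eq_iff E.iso_class_mult[OF preserves_product[OF p]]
        E.iso_class_mult[OF preserves_product[OF q]] E.iso_class_mult[OF preserves_product[OF p']]
        E.iso_class_mult[OF preserves_product[OF q']] intro!: bexI[of _ "FObj F k"])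
qed

lemma K_map_diff:
  assumes "a \<in> Obj D" "b \<in> Obj D"
  shows "K_map D E F (K_diff D a b) = K_diff E (FObj F a) (FObj F b)"
  unfolding K_map_def
proof (rule the_equality)
  show "\<exists>c\<in>Obj D. \<exists>d\<in>Obj D. K_diff D a b = K_diff D c d
      \<and> K_diff E (FObj F a) (FObj F b) = K_diff E (FObj F c) (FObj F d)"
    using assms by blast
qed (use assms K_diff_FObj_cong in metis)

lemma K_map_hom: "K_map D E F \<in> hom (K_group D) (K_group E)"
proof (rule homI)
  fix X assume "X \<in> carrier (K_group D)"
  then obtain a b where X: "X = K_diff D a b" "a \<in> Obj D" "b \<in> Obj D"
    by (auto simp: D.carrier_K)
  then show "K_map D E F X \<in> carrier (K_group E)"
    using FObj_closed by (auto simp: K_map_diff E.carrier_K)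
  fix Y assume "Y \<in> carrier (K_group D)"
  then obtain c d where Y: "Y = K_diff D c d" "c \<in> Obj D" "d \<in> Obj D"
    by (auto simp: D.carrier_K)
  obtain p \<alpha>\<^sub>1 \<alpha>\<^sub>2 where p: "is_product D p \<alpha>\<^sub>1 \<alpha>\<^sub>2 a c" using D.ex_product X Y by blast
  obtain q \<beta>\<^sub>1 \<beta>\<^sub>2 where q: "is_product D q \<beta>\<^sub>1 \<beta>\<^sub>2 b d" using D.ex_product X Y by blast
  show "K_map D E F (X \<otimes>\<^bsub>K_group D\<^esub> Y) = K_map D E F X \<otimes>\<^bsub>K_group E\<^esub> K_map D E F Y"
    using X Y D.is_productD(1)[OF p] D.is_productD(1)[OF q]
    by (simp add: D.K_diff_mult[OF p q] K_map_diff
        E.K_diff_mult[OF preserves_product[OF p] preserves_product[OF q]])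
qed

end

lemma coslice_simps:
  "Obj (coslice m C) = {(a, f). a \<in> Obj C \<and> f \<in> Hom C m a}"
  "Hom (coslice m C) (a, f) (b, g) = {\<chi> \<in> Hom C a b. Comp C m a b \<chi> f = g}"
  "Comp (coslice m C) (a, f) (b, g) (c, h) = Comp C a b c"
  "Ident (coslice m C) (a, f) = Ident C a"
  by (simp_all add: coslice_def)

lemma (in category) category_coslice:
  assumes "m \<in> Obj C"
  shows "category (coslice m C)"
proof unfold_locales
  fix A B D f g
  assume "A \<in> Obj (coslice m C)" "B \<in> Obj (coslice m C)" "D \<in> Obj (coslice m C)"
    "f \<in> Hom (coslice m C) A B" "g \<in> Hom (coslice m C) B D"
  then show "Comp (coslice m C) A B D g f \<in> Hom (coslice m C) A D"
    using assms by (auto simp: coslice_simps Comp_closed Comp_assoc[symmetric])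
qed (use assms in \<open>auto simp: coslice_simps Ident_closed Ident_left Ident_right Comp_assoc\<close>)

context fp_category
begin

lemma coslice_product:
  assumes m: "m \<in> Obj C" and p: "is_product C p \<pi>\<^sub>1 \<pi>\<^sub>2 a b" and h: "h \<in> Hom C m p"
  shows "is_product (coslice m C) (p, h) \<pi>\<^sub>1 \<pi>\<^sub>2
    (a, Comp C m p a \<pi>\<^sub>1 h) (b, Comp C m p b \<pi>\<^sub>2 h)"
proof -
  note [simp] = m h is_productD[OF p]
  interpret S: category "coslice m C" by (rule category_coslice[OF m])
  show ?thesis
  proof (rule S.is_productI)
    fix X f g assume X: "X \<in> Obj (coslice m C)"
      "f \<in> Hom (coslice m C) X (a, Comp C m p a \<pi>\<^sub>1 h)"
      "g \<in> Hom (coslice m C) X (b, Comp C m p b \<pi>\<^sub>2 h)"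
    obtain x u where xu: "X = (x, u)" by (cases X)
    note X' = X[unfolded xu coslice_simps, simplified]
    obtain k where k: "k \<in> Hom C x p" "Comp C x p a \<pi>\<^sub>1 k = f" "Comp C x p b \<pi>\<^sub>2 k = g"
      by (rule is_product_ex[OF p, of x f g]) (use X' in auto)
    have "Comp C m x p k u = h"
      by (rule is_product_eqI[OF p m]) (use X' k in \<open>auto intro: Comp_closed simp: Comp_assoc\<close>)
    then show "\<exists>k\<in>Hom (coslice m C) X (p, h).
        Comp (coslice m C) X (p, h) (a, Comp C m p a \<pi>\<^sub>1 h) \<pi>\<^sub>1 k = f \<and>
        Comp (coslice m C) X (p, h) (b, Comp C m p b \<pi>\<^sub>2 h) \<pi>\<^sub>2 k = g"
      using k by (auto simp: xu coslice_simps)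
  next
    fix X k l assume X: "X \<in> Obj (coslice m C)"
      "k \<in> Hom (coslice m C) X (p, h)" "l \<in> Hom (coslice m C) X (p, h)"
      "Comp (coslice m C) X (p, h) (a, Comp C m p a \<pi>\<^sub>1 h) \<pi>\<^sub>1 k
        = Comp (coslice m C) X (p, h) (a, Comp C m p a \<pi>\<^sub>1 h) \<pi>\<^sub>1 l"
      "Comp (coslice m C) X (p, h) (b, Comp C m p b \<pi>\<^sub>2 h) \<pi>\<^sub>2 k
        = Comp (coslice m C) X (p, h) (b, Comp C m p b \<pi>\<^sub>2 h) \<pi>\<^sub>2 l"
    obtain x u where xu: "X = (x, u)" by (cases X)
    note X' = X[unfolded xu coslice_simps, simplified]
    show "k = l" by (rule is_product_eqI[OF p, of x]) (use X' in auto)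
  qed (auto simp: coslice_simps intro: Comp_closed)
qed

lemma coslice_product_ex:
  assumes m: "m \<in> Obj C" and f: "f \<in> Hom C m a" "g \<in> Hom C m b" and p: "is_product C p \<pi>\<^sub>1 \<pi>\<^sub>2 a b"
  shows "\<exists>h. is_product (coslice m C) (p, h) \<pi>\<^sub>1 \<pi>\<^sub>2 (a, f) (b, g)"
  by (rule is_product_ex[OF p m f]) (use coslice_product[OF m p] in blast)

lemma coslice_terminal:
  assumes m: "m \<in> Obj C" and t: "is_terminal C t" and h: "h \<in> Hom C m t"
  shows "is_terminal (coslice m C) (t, h)"
proof -
  have o: "t \<in> Obj C" using t by (auto simp: is_terminal_def)
  show ?thesis
    unfolding is_terminal_def
  proof (intro conjI ballI)
    show "(t, h) \<in> Obj (coslice m C)" using o h by (simp add: coslice_simps)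
    fix X assume "X \<in> Obj (coslice m C)"
    then obtain x u where xu: "X = (x, u)" "x \<in> Obj C" "u \<in> Hom C m x"
      by (auto simp: coslice_simps)
    obtain k where k: "k \<in> Hom C x t" using is_terminal_ex[OF t xu(2)] .
    have "Comp C m x t k u = h"
      by (rule is_terminal_eqI[OF t m]) (use xu k m o h in \<open>auto intro: Comp_closed\<close>)
    then show "\<exists>!k. k \<in> Hom (coslice m C) X (t, h)"
      using k is_terminal_eqI[OF t xu(2)] by (auto simp: xu(1) coslice_simps)
  qed
qed

lemma fp_category_coslice:
  assumes m: "m \<in> Obj C"
  shows "fp_category (coslice m C)"
proof -
  interpret S: category "coslice m C" by (rule category_coslice[OF m])
  show ?thesis
  proof unfold_locales
    obtain t where t: "is_terminal C t" using ex_terminal by blast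
    obtain h where "h \<in> Hom C m t" using is_terminal_ex[OF t m] .
    then show "\<exists>t. is_terminal (coslice m C) t" using coslice_terminal[OF m t] by blast
    fix X Y assume "X \<in> Obj (coslice m C)" "Y \<in> Obj (coslice m C)"
    then obtain a f b g where X: "X = (a, f)" "Y = (b, g)" "a \<in> Obj C" "b \<in> Obj C"
        "f \<in> Hom C m a" "g \<in> Hom C m b" by (auto simp: coslice_simps)
    obtain p \<pi>\<^sub>1 \<pi>\<^sub>2 where p: "is_product C p \<pi>\<^sub>1 \<pi>\<^sub>2 a b" using ex_product X by blast
    show "\<exists>p \<pi>\<^sub>1 \<pi>\<^sub>2. is_product (coslice m C) p \<pi>\<^sub>1 \<pi>\<^sub>2 X Y"
      using coslice_product_ex[OF m X(5,6) p] X by blast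
  qed
qed

lemma product_functor_forget:
  assumes m: "m \<in> Obj C"
  shows "product_functor (coslice m C) C forget_functor"
proof -
  interpret S: fp_category "coslice m C" by (rule fp_category_coslice[OF m])
  show ?thesis
  proof unfold_locales
    fix T assume T: "is_terminal (coslice m C) T"
    then obtain s v where s: "T = (s, v)" "s \<in> Obj C" by (auto simp: is_terminal_def coslice_simps)
    obtain t where t: "is_terminal C t" using ex_terminal by blast
    obtain h where h: "h \<in> Hom C m t" using is_terminal_ex[OF t m] .
    have "isomorphic (coslice m C) (t, h) T"
      using S.terminal_iso[OF coslice_terminal[OF m t h] T] .
    then have "isomorphic C t s"
      unfolding isomorphic_def s(1) by (auto simp: coslice_simps)
    then show "is_terminal C (FObj forget_functor T)"
      using iso_terminal[OF t] s by (simp add: forget_functor_def)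
  next
    fix P \<rho>\<^sub>1 \<rho>\<^sub>2 A B assume P: "is_product (coslice m C) P \<rho>\<^sub>1 \<rho>\<^sub>2 A B"
    obtain a f b g q v where X: "A = (a, f)" "B = (b, g)" "P = (q, v)" "a \<in> Obj C" "b \<in> Obj C"
        "f \<in> Hom C m a" "g \<in> Hom C m b" "q \<in> Obj C"
      using S.is_productD(1-3)[OF P] by (auto simp: coslice_simps)
    obtain p \<pi>\<^sub>1 \<pi>\<^sub>2 where p: "is_product C p \<pi>\<^sub>1 \<pi>\<^sub>2 a b" using ex_product X by blast
    obtain h where h: "is_product (coslice m C) (p, h) \<pi>\<^sub>1 \<pi>\<^sub>2 A B"
      using coslice_product_ex[OF m X(6,7) p] X by blast
    obtain k k' where "k \<in> Hom (coslice m C) P (p, h)" "k' \<in> Hom (coslice m C) (p, h) P"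
      "Comp (coslice m C) P (p, h) P k' k = Ident (coslice m C) P"
      "Comp (coslice m C) (p, h) P (p, h) k k' = Ident (coslice m C) (p, h)"
      "Comp (coslice m C) P (p, h) A \<pi>\<^sub>1 k = \<rho>\<^sub>1" "Comp (coslice m C) P (p, h) B \<pi>\<^sub>2 k = \<rho>\<^sub>2"
      using S.product_comparison[OF h P] .
    then have k: "k \<in> Hom C q p" "k' \<in> Hom C p q" "Comp C q p q k' k = Ident C q"
      "Comp C p q p k k' = Ident C p" "Comp C q p a \<pi>\<^sub>1 k = \<rho>\<^sub>1" "Comp C q p b \<pi>\<^sub>2 k = \<rho>\<^sub>2"
      by (auto simp: X(1-3) coslice_simps)
    then have "is_product C q \<rho>\<^sub>1 \<rho>\<^sub>2 a b"
      using product_transport_obj[OF p X(8) k(1-4)] by simp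
    then show "is_product C (FObj forget_functor P) (FHom forget_functor P A \<rho>\<^sub>1)
        (FHom forget_functor P B \<rho>\<^sub>2) (FObj forget_functor A) (FObj forget_functor B)"
      by (simp add: forget_functor_def X)
  qed (auto simp: forget_functor_def coslice_simps)
qed

end

context additive_category
begin

lemma Zero_closed: "\<lbrakk>a \<in> Obj C; b \<in> Obj C\<rbrakk> \<Longrightarrow> Zero C a b \<in> Hom C a b"
  using monoid.one_closed[OF comm_monoid.axioms(1)[OF comm_group.axioms(1)[OF hom_group]]]
  by (simp add: hom_group_def)

lemma Add_closed:
  "\<lbrakk>a \<in> Obj C; b \<in> Obj C; f \<in> Hom C a b; g \<in> Hom C a b\<rbrakk> \<Longrightarrow> Add C a b f g \<in> Hom C a b"
  using monoid.m_closed[OF comm_monoid.axioms(1)[OF comm_group.axioms(1)[OF hom_group]]]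
  by (simp add: hom_group_def)

lemma Add_Zero:
  assumes "a \<in> Obj C" "b \<in> Obj C" "f \<in> Hom C a b"
  shows "Add C a b f (Zero C a b) = f" "Add C a b (Zero C a b) f = f"
  using monoid.r_one[OF comm_monoid.axioms(1)[OF comm_group.axioms(1)[OF hom_group]]]
    monoid.l_one[OF comm_monoid.axioms(1)[OF comm_group.axioms(1)[OF hom_group]]] assms
  by (simp_all add: hom_group_def)

lemma Add_idem:
  assumes "a \<in> Obj C" "b \<in> Obj C" "f \<in> Hom C a b" "Add C a b f f = f"
  shows "f = Zero C a b"
  using group.l_cancel_one[OF comm_group.axioms(2)[OF hom_group[OF assms(1,2)]], of f f] assms
  by (simp add: hom_group_def)

lemma Comp_Zero_right:
  assumes "a \<in> Obj C" "b \<in> Obj C" "c \<in> Obj C" "g \<in> Hom C b c"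
  shows "Comp C a b c g (Zero C a b) = Zero C a c"
  using Comp_Add_right[OF assms(1-3) Zero_closed Zero_closed assms(4)] assms
  by (intro Add_idem) (auto simp: Add_Zero Zero_closed Comp_closed)

lemma Comp_Zero_left:
  assumes "a \<in> Obj C" "b \<in> Obj C" "c \<in> Obj C" "f \<in> Hom C a b"
  shows "Comp C a b c (Zero C b c) f = Zero C a c"
  using Comp_Add_left[OF assms(1-4) Zero_closed Zero_closed] assms
  by (intro Add_idem) (auto simp: Add_Zero Zero_closed Comp_closed)

lemma biproduct_is_product:
  assumes bi: "is_biproduct C c p\<^sub>1 p\<^sub>2 i\<^sub>1 i\<^sub>2 a b"
  shows "is_product C c p\<^sub>1 p\<^sub>2 a b"
proof -
  have [simp]: "c \<in> Obj C" "a \<in> Obj C" "b \<in> Obj C"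
    "p\<^sub>1 \<in> Hom C c a" "p\<^sub>2 \<in> Hom C c b" "i\<^sub>1 \<in> Hom C a c" "i\<^sub>2 \<in> Hom C b c"
    "Comp C a c a p\<^sub>1 i\<^sub>1 = Ident C a" "Comp C b c b p\<^sub>2 i\<^sub>2 = Ident C b"
    "Comp C b c a p\<^sub>1 i\<^sub>2 = Zero C b a" "Comp C a c b p\<^sub>2 i\<^sub>1 = Zero C a b"
    and sum: "Add C c c (Comp C c a c i\<^sub>1 p\<^sub>1) (Comp C c b c i\<^sub>2 p\<^sub>2) = Ident C c"
    using bi by (auto simp: is_biproduct_def)
  show ?thesis
  proof (rule is_productI)
    fix x f g assume [simp]: "x \<in> Obj C" "f \<in> Hom C x a" "g \<in> Hom C x b"
    show "\<exists>h\<in>Hom C x c. Comp C x c a p\<^sub>1 h = f \<and> Comp C x c b p\<^sub>2 h = g"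
      by (intro bexI[of _ "Add C x c (Comp C x a c i\<^sub>1 f) (Comp C x b c i\<^sub>2 g)"] conjI)
        (simp_all add: Comp_Add_right Comp_closed Comp_assoc Ident_left Comp_Zero_left Add_Zero
          Add_closed)
  next
    fix x h k assume [simp]: "x \<in> Obj C" "h \<in> Hom C x c" "k \<in> Hom C x c"
      and eq: "Comp C x c a p\<^sub>1 h = Comp C x c a p\<^sub>1 k" "Comp C x c b p\<^sub>2 h = Comp C x c b p\<^sub>2 k"
    have "l = Add C x c (Comp C x a c i\<^sub>1 (Comp C x c a p\<^sub>1 l)) (Comp C x b c i\<^sub>2 (Comp C x c b p\<^sub>2 l))"
      if [simp]: "l \<in> Hom C x c" for l
    proof -
      have "l = Comp C x c c (Ident C c) l" by (simp add: Ident_left)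
      also have "\<dots> = Add C x c (Comp C x a c i\<^sub>1 (Comp C x c a p\<^sub>1 l))
          (Comp C x b c i\<^sub>2 (Comp C x c b p\<^sub>2 l))"
        unfolding sum[symmetric] by (simp add: Comp_Add_left Comp_closed Comp_assoc)
      finally show ?thesis .
    qed
    then show "h = k" using eq by (metis \<open>h \<in> Hom C x c\<close> \<open>k \<in> Hom C x c\<close>)
  qed auto
qed

lemma fp_category: "fp_category C"
  by unfold_locales (use ex_zero_object ex_biproduct biproduct_is_product in blast)+

lemma product_functor_zero_section:
  assumes m: "m \<in> Obj C"
  shows "product_functor C (coslice m C) (zero_section m C)"
proof -
  interpret C: fp_category C by (rule fp_category)
  interpret S: fp_category "coslice m C" by (rule C.fp_category_coslice[OF m])
  show ?thesis
  proof unfold_locales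
    fix t assume t: "is_terminal C t"
    then have "t \<in> Obj C" by (auto simp: is_terminal_def)
    then show "is_terminal (coslice m C) (FObj (zero_section m C) t)"
      using C.coslice_terminal[OF m t Zero_closed] m by (simp add: zero_section_def)
  next
    fix p \<pi>\<^sub>1 \<pi>\<^sub>2 a b assume p: "is_product C p \<pi>\<^sub>1 \<pi>\<^sub>2 a b"
    note [simp] = m is_productD[OF p]
    show "is_product (coslice m C) (FObj (zero_section m C) p) (FHom (zero_section m C) p a \<pi>\<^sub>1)
        (FHom (zero_section m C) p b \<pi>\<^sub>2) (FObj (zero_section m C) a) (FObj (zero_section m C) b)"
      using C.coslice_product[OF m p Zero_closed] by (simp add: zero_section_def Comp_Zero_right)
  qed (use m in \<open>auto simp: zero_section_def coslice_simps Zero_closed Comp_Zero_right\<close>)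
qed

end

end

theory Submission
  imports Defs
begin

text \<open>
  Since \<open>U \<circ> S\<close> is the identity, everything rests on \<open>[(a, f)] = [(a, 0)]\<close> in \<open>K(m\<setminus>C)\<close>.
  The object \<open>(a \<oplus> a, (f, f))\<close> is a product of \<open>(a, f)\<close> with itself via the projections
  \<open>\<pi>\<^sub>1, \<pi>\<^sub>2\<close>, but also a product of \<open>(a, 0)\<close> and \<open>(a, f)\<close> via the sheared projections
  \<open>\<pi>\<^sub>1 - \<pi>\<^sub>2, \<pi>\<^sub>2\<close>. Hence \<open>[(a, f)] + [(a, f)] = [(a, 0)] + [(a, f)]\<close>, and one summand cancels.
\<close>

context additive_category
begin

lemma Add_assoc:
  assumes "a \<in> Obj C" "b \<in> Obj C" "f \<in> Hom C a b" "g \<in> Hom C a b" "h \<in> Hom C a b"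
  shows "Add C a b (Add C a b f g) h = Add C a b f (Add C a b g h)"
proof -
  interpret H: comm_group "hom_group C a b" by (rule hom_group[OF assms(1,2)])
  show ?thesis using H.m_assoc[of f g h] assms by (simp add: hom_group_def)
qed

lemma Add_right_cancel:
  assumes "a \<in> Obj C" "b \<in> Obj C" "f \<in> Hom C a b" "g \<in> Hom C a b" "h \<in> Hom C a b"
  shows "Add C a b f h = Add C a b g h \<longleftrightarrow> f = g"
proof -
  interpret H: comm_group "hom_group C a b" by (rule hom_group[OF assms(1,2)])
  show ?thesis using H.right_cancel[of h f g] assms by (simp add: hom_group_def)
qed

text \<open>The category record carries \<open>Add\<close> and \<open>Zero\<close> but no negation,
  so negatives enter the proofs below as witnesses.\<close>

lemma Add_inverse_ex:
  assumes "a \<in> Obj C" "b \<in> Obj C" "f \<in> Hom C a b"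
  obtains g where "g \<in> Hom C a b" "Add C a b f g = Zero C a b" "Add C a b g f = Zero C a b"
proof -
  interpret H: comm_group "hom_group C a b" by (rule hom_group[OF assms(1,2)])
  show thesis
    using that[of "inv\<^bsub>hom_group C a b\<^esub> f"] H.inv_closed[of f] H.r_inv[of f] H.l_inv[of f] assms
    by (simp add: hom_group_def)
qed

text \<open>In coordinates, the new projections are the old ones after the map (x, y) to (x + u y,
  y). This map is invertible, its inverse subtracting u y, so the universal property
  survives.\<close>

lemma is_product_shear:
  assumes p: "is_product C p \<pi>\<^sub>1 \<pi>\<^sub>2 a b" and u: "u \<in> Hom C b a"
  shows "is_product C p (Add C p a \<pi>\<^sub>1 (Comp C p b a u \<pi>\<^sub>2)) \<pi>\<^sub>2 a b"
proof -
  note [simp] = is_productD[OF p] u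
  obtain v where [simp]: "v \<in> Hom C b a" and v: "Add C b a v u = Zero C b a"
    using Add_inverse_ex[of b a u] by auto
  have sheared: "Comp C x p a (Add C p a \<pi>\<^sub>1 (Comp C p b a u \<pi>\<^sub>2)) h
      = Add C x a (Comp C x p a \<pi>\<^sub>1 h) (Comp C x b a u (Comp C x p b \<pi>\<^sub>2 h))"
    if "x \<in> Obj C" "h \<in> Hom C x p" for x h
    using that by (simp add: Comp_Add_left Comp_closed Comp_assoc)
  show ?thesis
  proof (rule is_productI)
    fix x f g assume [simp]: "x \<in> Obj C" "f \<in> Hom C x a" "g \<in> Hom C x b"
    \<comment> \<open>With \<open>v\<close> the negative of \<open>u\<close>, the first coordinate
      has to be f - u g, since the shear adds u g back.\<close>
    obtain k where k: "k \<in> Hom C x p" "Comp C x p a \<pi>\<^sub>1 k = Add C x a f (Comp C x b a v g)"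
        "Comp C x p b \<pi>\<^sub>2 k = g"
      by (rule is_product_ex[OF p, of x "Add C x a f (Comp C x b a v g)" g])
        (simp_all add: Add_closed Comp_closed)
    have "Add C x a (Add C x a f (Comp C x b a v g)) (Comp C x b a u g)
        = Add C x a f (Comp C x b a (Add C b a v u) g)"
      by (simp add: Add_assoc Comp_Add_left Comp_closed)
    also have "\<dots> = f" by (simp add: v Comp_Zero_left Add_Zero)
    finally show "\<exists>k\<in>Hom C x p. Comp C x p a (Add C p a \<pi>\<^sub>1 (Comp C p b a u \<pi>\<^sub>2)) k = f
        \<and> Comp C x p b \<pi>\<^sub>2 k = g"
      using k by (intro bexI[of _ k]) (simp_all add: sheared)
  next
    fix x h k assume [simp]: "x \<in> Obj C" "h \<in> Hom C x p" "k \<in> Hom C x p"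
      and eq: "Comp C x p a (Add C p a \<pi>\<^sub>1 (Comp C p b a u \<pi>\<^sub>2)) h
          = Comp C x p a (Add C p a \<pi>\<^sub>1 (Comp C p b a u \<pi>\<^sub>2)) k"
        "Comp C x p b \<pi>\<^sub>2 h = Comp C x p b \<pi>\<^sub>2 k"
    \<comment> \<open>The second coordinates agree, so the summands that the shear adds agree as
      well and cancel.\<close>
    then have "Comp C x p a \<pi>\<^sub>1 h = Comp C x p a \<pi>\<^sub>1 k"
      by (simp add: sheared Add_right_cancel Comp_closed)
    then show "h = k" using eq(2) by - (rule is_product_eqI[OF p, of x], simp_all)
  qed (simp_all add: Add_closed Comp_closed)
qed

text \<open>The relation is stated in the monoid of isomorphism classes, where cancellation may
  fail; the common factor is removed only after passing to K.\<close>

lemma coslice_iso_class_absorb: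
  assumes m: "m \<in> Obj C" and a: "a \<in> Obj C" and f: "f \<in> Hom C m a"
  shows "iso_class (coslice m C) (a, f) \<otimes>\<^bsub>iso_class_monoid (coslice m C)\<^esub> iso_class (coslice m C) (a, f)
    = iso_class (coslice m C) (a, Zero C m a) \<otimes>\<^bsub>iso_class_monoid (coslice m C)\<^esub> iso_class (coslice m C) (a, f)"
proof -
  interpret C: fp_category C by (rule fp_category)
  interpret S: fp_category "coslice m C" by (rule C.fp_category_coslice[OF m])
  obtain p \<pi>\<^sub>1 \<pi>\<^sub>2 where p: "is_product C p \<pi>\<^sub>1 \<pi>\<^sub>2 a a" using C.ex_product[OF a a] by blast
  note [simp] = m a f is_productD[OF p] Ident_closed
  obtain h where h [simp]: "h \<in> Hom C m p"
    and h_eq: "Comp C m p a \<pi>\<^sub>1 h = f" "Comp C m p a \<pi>\<^sub>2 h = f"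
    using is_product_ex[OF p m f f] .
  \<comment> \<open>With \<open>u\<close> the negative of the identity, the sheared first projection
    is the difference of the two projections. It kills \<open>h\<close>, because both coordinates of
    \<open>h\<close> are \<open>f\<close>.\<close>
  obtain u where [simp]: "u \<in> Hom C a a" and u: "Add C a a (Ident C a) u = Zero C a a"
    using Add_inverse_ex[of a a "Ident C a"] by auto
  have "Comp C m p a (Add C p a \<pi>\<^sub>1 (Comp C p a a u \<pi>\<^sub>2)) h
      = Add C m a (Comp C m a a (Ident C a) f) (Comp C m a a u f)"
    by (simp add: Comp_Add_left Comp_closed Comp_assoc[symmetric] h_eq Ident_left)
  also have "\<dots> = Zero C m a"
    by (simp add: Comp_Add_left[symmetric] u Comp_Zero_left)
  finally have "is_product (coslice m C) (p, h) (Add C p a \<pi>\<^sub>1 (Comp C p a a u \<pi>\<^sub>2)) \<pi>\<^sub>2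
      (a, Zero C m a) (a, f)"
    using C.coslice_product[OF m is_product_shear[OF p, of u] h] by (simp add: h_eq)
  moreover have "is_product (coslice m C) (p, h) \<pi>\<^sub>1 \<pi>\<^sub>2 (a, f) (a, f)"
    using C.coslice_product[OF m p h] by (simp add: h_eq)
  \<comment> \<open>Both products have the same underlying object \<open>(p, h)\<close>, so each
    side equals its class.\<close>
  ultimately show ?thesis using S.iso_class_mult by metis
qed

text \<open>Equality in K may be tested after adding a common object. Adding the product of (a, f)
  and (b, g) supplies the extra factor that absorption needs for \<open>a\<close> and for
  \<open>b\<close> at once.\<close>

lemma coslice_K_diff_Zero:
  assumes m: "m \<in> Obj C" and a: "a \<in> Obj C" "f \<in> Hom C m a" and b: "b \<in> Obj C" "g \<in> Hom C m b"
  shows "K_diff (coslice m C) (a, Zero C m a) (b, Zero C m b) = K_diff (coslice m C) (a, f) (b, g)"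
proof -
  interpret C: fp_category C by (rule fp_category)
  interpret S: fp_category "coslice m C" by (rule C.fp_category_coslice[OF m])
  interpret M: comm_monoid "iso_class_monoid (coslice m C)"
    by (rule S.comm_monoid_iso_class_monoid)
  let ?i = "iso_class (coslice m C)"
  let ?A = "?i (a, f)" and ?B = "?i (b, g)"
  let ?A' = "?i (a, Zero C m a)" and ?B' = "?i (b, Zero C m b)"
  have o: "(a, f) \<in> Obj (coslice m C)" "(b, g) \<in> Obj (coslice m C)"
    "(a, Zero C m a) \<in> Obj (coslice m C)" "(b, Zero C m b) \<in> Obj (coslice m C)"
    using assms by (auto simp: coslice_simps Zero_closed)
  note c = o[THEN S.iso_class_carrier]
  obtain k \<pi>\<^sub>1 \<pi>\<^sub>2 where k: "is_product (coslice m C) k \<pi>\<^sub>1 \<pi>\<^sub>2 (a, f) (b, g)"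
    using S.ex_product[OF o(1,2)] by blast
  let ?m = "mult (iso_class_monoid (coslice m C))"
  have "?m (?m ?A' ?B) (?m ?A ?B) = ?m (?m ?A' ?A) (?m ?B ?B)"
    using c by (simp add: M.m_ac)
  \<comment> \<open>Absorption is used in opposite directions: \<open>?A'\<close> becomes
    \<open>?A\<close> in the first factor, and one \<open>?B\<close> becomes \<open>?B'\<close> in
    the second.\<close>
  also have "\<dots> = ?m (?m ?A ?A) (?m ?B' ?B)"
    by (simp only: coslice_iso_class_absorb[OF m a] coslice_iso_class_absorb[OF m b])
  also have "\<dots> = ?m (?m ?A ?B') (?m ?A ?B)"
    using c by (simp add: M.m_ac)
  finally show ?thesis
    unfolding S.K_diff_eq_iff[OF o(3,4,1,2)] S.iso_class_mult[OF k]
    by (rule bexI[OF _ S.is_productD(1)[OF k]])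
qed

end

theorem lemmaE:
  fixes C :: "('o, 'm, 'e) additive_category_scheme" and m :: 'o
  assumes "additive_category C" and "m \<in> Obj C"
  shows "K_map (coslice m C) C forget_functor \<in> iso (K_group (coslice m C)) (K_group C) \<and>
    K_map C (coslice m C) (zero_section m C) \<in> hom (K_group C) (K_group (coslice m C)) \<and>
    (\<forall>x\<in>carrier (K_group (coslice m C)).
      K_map C (coslice m C) (zero_section m C) (K_map (coslice m C) C forget_functor x) = x) \<and>
    (\<forall>y\<in>carrier (K_group C).
      K_map (coslice m C) C forget_functor (K_map C (coslice m C) (zero_section m C) y) = y)"
proof -
  interpret additive_category C by (rule assms(1))
  interpret C: fp_category C by (rule fp_category)
  interpret U: product_functor "coslice m C" C forget_functor
    by (rule C.product_functor_forget[OF assms(2)])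
  interpret S: product_functor C "coslice m C" "zero_section m C"
    by (rule product_functor_zero_section[OF assms(2)])
  let ?U = "K_map (coslice m C) C forget_functor" and ?S = "K_map C (coslice m C) (zero_section m C)"
  have FObj_U: "FObj forget_functor (a, f) = a" for a :: 'o and f :: 'm
    by (simp add: forget_functor_def)
  have FObj_S: "FObj (zero_section m C) a = (a, Zero C m a)" for a
    by (simp add: zero_section_def)
  \<comment> \<open>The round trip replaces both structure maps by zero, which changes the object
    but not the difference in K.\<close>
  have SU: "?S (?U x) = x" if x: "x \<in> carrier (K_group (coslice m C))" for x
  proof -
    obtain a f b g where X: "x = K_diff (coslice m C) (a, f) (b, g)"
      and ab: "a \<in> Obj C" "f \<in> Hom C m a" "b \<in> Obj C" "g \<in> Hom C m b"
      using x by (auto simp: U.D.carrier_K coslice_simps)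
    have "?U x = K_diff C a b"
      unfolding X using ab by (subst U.K_map_diff) (auto simp: coslice_simps FObj_U)
    then show ?thesis
      using ab by (simp only: X S.K_map_diff FObj_S coslice_K_diff_Zero[OF assms(2) ab])
  qed
  \<comment> \<open>In this order the functors compose to the identity on objects, so no relation in
    K is needed.\<close>
  have US: "?U (?S y) = y" if y: "y \<in> carrier (K_group C)" for y
  proof -
    obtain a b where Y: "y = K_diff C a b" and ab: "a \<in> Obj C" "b \<in> Obj C"
      using y unfolding C.carrier_K by blast
    have "?S y = K_diff (coslice m C) (a, Zero C m a) (b, Zero C m b)"
      using ab by (simp only: Y S.K_map_diff FObj_S)
    then show ?thesis
      using U.K_map_diff[OF S.FObj_closed[OF ab(1)] S.FObj_closed[OF ab(2)]]
      by (simp only: Y FObj_S FObj_U)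
  qed
  have "bij_betw ?U (carrier (K_group (coslice m C))) (carrier (K_group C))"
  proof (rule bij_betw_byWitness)
    show "\<forall>x\<in>carrier (K_group (coslice m C)). ?S (?U x) = x" by (intro ballI SU)
    show "\<forall>y\<in>carrier (K_group C). ?U (?S y) = y" by (intro ballI US)
    show "?U ` carrier (K_group (coslice m C)) \<subseteq> carrier (K_group C)"
      by (intro image_subsetI hom_in_carrier[OF U.K_map_hom])
    show "?S ` carrier (K_group C) \<subseteq> carrier (K_group (coslice m C))"
      by (intro image_subsetI hom_in_carrier[OF S.K_map_hom])
  qed
  then show ?thesis
    unfolding iso_def by (intro conjI ballI CollectI U.K_map_hom S.K_map_hom SU US)
qed

end
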